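(* Let $k\ge 1$ and $n>k$ be integers. Then $$\inf_{\mathbf G}\sup_{J,\rho}\ \mathrm{innerLP}^{\mathsf{OST}(J,\rho)/\mathsf{Proph}}_{k,n}(\mathbf G)=\inf_{\mathbf G}\sup_{J,\rho}\ \mathrm{innerLP}^{\mathsf{OST}(J,\rho)/\mathsf{ExAnte}}_{k,n}(\mathbf G)$$ $$=\inf_{\mathbf G}\sup_{J,\rho}\ \min\left\{\Pr\Big[\sum_{i<n}\mathrm{Ber}\big((1-\rho)G_{i,J-1}+\rho G_{iJ}\big)<k\Big],\ \frac{\mathbb E\big[\min\{\sum_{i<n}\mathrm{Ber}((1-\rho)G_{i,J-1}+\rho G_{iJ}),k\}\big]}{k}\right\},$$ where the infima are over all type distributions $\mathbf G$ for $n$ agents (with any finite number $m$ of types), and the suprema are over $J\in[m]$ and $\rho\in(0,1]$.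
   Context: $[n]=\{1,\dots,n\}$. $\mathrm{Ber}(p)$ denotes a Bernoulli random variable with mean $p$; all Bernoulli variables appearing in a sum are independent. Type distributions $\mathbf G$ (for $n$ agents): a positive integer $m$ and numbers $G_{ij}$, $i\in[n]$, $j\in\{0,1,\dots,m\}$, with $0=G_{i0}\le G_{i1}\le\cdots\le G_{im}=1$ for every $i$. $\mathcal P^k_n$ is the set of pairs $(\mathbf x,\mathbf y)$ of real arrays $\mathbf x=(x^l_i)_{i\in[n],l\in[k]}$, $\mathbf y=(y^l_i)_{i\in[n],l\in[k]}$ such that $0\le y^l_i\le x^l_i$ for all $i,l$; $x^k_1=1$; $x^l_1=0$ for $l<k$; and $x^l_i=x^l_{i-1}-y^l_{i-1}+y^{l+1}_{i-1}$ for all $i>1$, $l\in[k]$, with the convention $y^{k+1}_{i}=0$. For $J\in[m]$, $\rho\in(0,1]$, $\mathrm{innerLP}^{\mathsf{OST}(J,\rho)/\mathsf{Proph}}_{k,n}(\mathbf G)$ (resp. $\mathrm{innerLP}^{\mathsf{OST}(J,\rho)/\mathsf{ExAnte}}_{k,n}(\mathbf G)$) is the optimal value of: maximize $\theta$ over real $\theta$ and $(\mathbf x,\mathbf y)\in\mathcal P^k_n$ subject to $$\theta\cdot Q_j\le\sum_{i=1}^n\sum_{l=1}^k\min\{y^l_i,G_{ij}x^l_i\}\quad\forall j\in[m],\qquad y^l_i=((1-\rho)G_{i,J-1}+\rho G_{iJ})x^l_i\quad\forall i\in[n],l\in[k],$$ where $Q_j=\mathbb E[\min\{\sum_{i=1}^n\mathrm{Ber}(G_{ij}),k\}]$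 (resp. $Q_j=\min\{\sum_{i=1}^nG_{ij},k\}$). *)

theory Defs
  imports "HOL-Probability.Probability"
begin

text \<open>Agents and remaining capacities are indexed from 1, as in \<open>[n] = {1..n}\<close>. Arrays are total
  functions on natural numbers; nothing below depends on entries outside the stated index ranges.\<close>

definition type_dists :: "nat \<Rightarrow> (nat \<times> (nat \<Rightarrow> nat \<Rightarrow> real)) set" where
  "type_dists n = {(m, G). m \<ge> 1 \<and>
     (\<forall>i\<in>{1..n}. G i 0 = 0 \<and> (\<forall>j<m. G i j \<le> G i (Suc j)) \<and> G i m = 1)}"

text \<open>Law of a sum over \<open>I\<close> of independent Bernoulli variables with means \<open>p i\<close>; only meaningful
  when every \<open>p i\<close> lies in \<open>[0,1]\<close>.\<close>

definition bernoulli_sum_pmf :: "nat set \<Rightarrow> (nat \<Rightarrow> real) \<Rightarrow> nat pmf" where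
  "bernoulli_sum_pmf I p =
     map_pmf (\<lambda>w. \<Sum>i\<in>I. of_bool (w i)) (Pi_pmf I False (\<lambda>i. bernoulli_pmf (p i)))"

definition prob_sum_less :: "nat set \<Rightarrow> (nat \<Rightarrow> real) \<Rightarrow> nat \<Rightarrow> real" where
  "prob_sum_less I p k = measure_pmf.prob (bernoulli_sum_pmf I p) {s. s < k}"

definition expect_min_sum :: "nat set \<Rightarrow> (nat \<Rightarrow> real) \<Rightarrow> nat \<Rightarrow> real" where
  "expect_min_sum I p k = measure_pmf.expectation (bernoulli_sum_pmf I p) (\<lambda>s. real (min s k))"

text \<open>\<open>x l i\<close> stands for \<open>x\<^sup>l\<^sub>i\<close>. The convention \<open>y\<^sup>k\<^sup>+\<^sup>1\<^sub>i = 0\<close> is the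
  \<open>else\<close> branch.\<close>

definition policy_polytope ::
    "nat \<Rightarrow> nat \<Rightarrow> ((nat \<Rightarrow> nat \<Rightarrow> real) \<times> (nat \<Rightarrow> nat \<Rightarrow> real)) set" where
  "policy_polytope k n = {(x, y).
     (\<forall>i\<in>{1..n}. \<forall>l\<in>{1..k}. 0 \<le> y l i \<and> y l i \<le> x l i) \<and>
     x k 1 = 1 \<and> (\<forall>l\<in>{1..<k}. x l 1 = 0) \<and>
     (\<forall>i\<in>{2..n}. \<forall>l\<in>{1..k}.
        x l i = x l (i - 1) - y l (i - 1) + (if l < k then y (l + 1) (i - 1) else 0))}"

definition ost_prob :: "(nat \<Rightarrow> nat \<Rightarrow> real) \<Rightarrow> nat \<Rightarrow> real \<Rightarrow> nat \<Rightarrow> real" where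
  "ost_prob G J \<rho> i = (1 - \<rho>) * G i (J - 1) + \<rho> * G i J"

text \<open>The optimal value is taken in the extended reals, so that suprema and infima
  never take unspecified values.\<close>

definition innerLP_OST ::
    "(nat \<Rightarrow> real) \<Rightarrow> nat \<Rightarrow> nat \<Rightarrow> nat \<Rightarrow> (nat \<Rightarrow> nat \<Rightarrow> real) \<Rightarrow> nat \<Rightarrow> real \<Rightarrow> ereal" where
  "innerLP_OST Q k n m G J \<rho> = Sup {ereal \<theta> |\<theta>. \<exists>(x, y)\<in>policy_polytope k n.
     (\<forall>j\<in>{1..m}. \<theta> * Q j \<le> (\<Sum>i=1..n. \<Sum>l=1..k. min (y l i) (G i j * x l i))) \<and>
     (\<forall>i\<in>{1..n}. \<forall>l\<in>{1..k}. y l i = ost_prob G J \<rho> i * x l i)}"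

definition innerLP_OST_Proph ::
    "nat \<Rightarrow> nat \<Rightarrow> nat \<Rightarrow> (nat \<Rightarrow> nat \<Rightarrow> real) \<Rightarrow> nat \<Rightarrow> real \<Rightarrow> ereal" where
  "innerLP_OST_Proph k n m G J \<rho> =
     innerLP_OST (\<lambda>j. expect_min_sum {1..n} (\<lambda>i. G i j) k) k n m G J \<rho>"

definition innerLP_OST_ExAnte ::
    "nat \<Rightarrow> nat \<Rightarrow> nat \<Rightarrow> (nat \<Rightarrow> nat \<Rightarrow> real) \<Rightarrow> nat \<Rightarrow> real \<Rightarrow> ereal" where
  "innerLP_OST_ExAnte k n m G J \<rho> =
     innerLP_OST (\<lambda>j. min (\<Sum>i=1..n. G i j) (real k)) k n m G J \<rho>"

end

theory Submission
  imports Defs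
begin

text \<open>Write \<open>p\<close> for the acceptance probabilities of the policy and \<open>A\<close> for the probability that
  capacity remains when agent \<open>n\<close> arrives. The constraint for \<open>j \<ge> J\<close> bounds \<open>\<theta>\<close> by
  \<open>E[min {\<Sum>\<^sub>i Ber (p\<^sub>i), k}] / Q\<^sub>j\<close>, and the constraint for \<open>j < J\<close> by a quotient that is at
  least \<open>A\<close>, since every agent finds remaining capacity with probability at least \<open>A\<close> and
  \<open>Q\<^sub>j \<le> \<Sum>\<^sub>i G\<^sub>i\<^sub>j\<close>. As \<open>Q\<^sub>j \<le> k\<close>, both linear programs dominate the explicit minimum for every
  \<open>G\<close>. Conversely, let agent \<open>n\<close> have a new best type with a small probability \<open>\<epsilon>\<close> and otherwise a
  new worst type: unless \<open>J = 1\<close>, when all rewards are of order \<open>\<epsilon>\<close>, the constraint for the best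
  type bounds \<open>\<theta>\<close> by \<open>A\<close>; the one for the worst type has \<open>Q\<^sub>j = k\<close>, and agent \<open>n\<close> changes the expectation by at most \<open>\<epsilon>\<close>.\<close>

section \<open>Sums of independent Bernoulli variables\<close>

lemma bernoulli_sum_pmf_insert:
  assumes "finite I" "i \<notin> I"
  shows "bernoulli_sum_pmf (insert i I) p =
    bind_pmf (bernoulli_pmf (p i)) (\<lambda>b. map_pmf (\<lambda>s. of_bool b + s) (bernoulli_sum_pmf I p))"
proof -
  have "(\<Sum>j\<in>I. of_bool ((w(i := b)) j)) = (\<Sum>j\<in>I. of_bool (w j) :: nat)" for w b
    using assms by (intro sum.cong) auto
  then have "(\<lambda>w. \<Sum>j\<in>insert i I. of_bool (w j) :: nat) \<circ> (\<lambda>(b, w). w(i := b)) =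
      (\<lambda>(b, w). of_bool b + (\<Sum>j\<in>I. of_bool (w j)))"
    using assms by (simp add: fun_eq_iff fun_upd_same del: fun_upd_apply sum_of_bool_eq)
  then show ?thesis
    unfolding bernoulli_sum_pmf_def Pi_pmf_insert[OF assms] pmf.map_comp
    by (simp add: pair_pmf_def map_pmf_def bind_assoc_pmf bind_return_pmf)
qed

lemma bernoulli_sum_pmf_empty [simp]: "bernoulli_sum_pmf {} p = return_pmf 0"
  by (simp add: bernoulli_sum_pmf_def)

lemma bernoulli_sum_pmf_cong:
  assumes "\<And>i. i \<in> I \<Longrightarrow> p i = q i" "finite I"
  shows "bernoulli_sum_pmf I p = bernoulli_sum_pmf I q"
  unfolding bernoulli_sum_pmf_def using assms
  by (intro arg_cong2[of _ _ _ _ map_pmf] Pi_pmf_cong) (auto simp: fun_eq_iff)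

lemma finite_set_bernoulli_sum_pmf:
  assumes "finite I"
  shows "finite (set_pmf (bernoulli_sum_pmf I p))"
  using assms by (induction I) (auto simp: bernoulli_sum_pmf_insert)

text \<open>Conditioning on the new Bernoulli variable; the recursions for the capped mean and for
  the point masses are instances.\<close>

lemma expectation_bernoulli_sum_insert:
  fixes f :: "nat \<Rightarrow> real"
  assumes "finite I" "i \<notin> I" "p i \<in> {0..1}"
  shows "measure_pmf.expectation (bernoulli_sum_pmf (insert i I) p) f =
    p i * measure_pmf.expectation (bernoulli_sum_pmf I p) (\<lambda>s. f (Suc s)) +
    (1 - p i) * measure_pmf.expectation (bernoulli_sum_pmf I p) f"
  unfolding bernoulli_sum_pmf_insert[OF assms(1,2)]
  using assms
  by (subst pmf_expectation_bind[where A = UNIV])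
    (auto simp: finite_set_bernoulli_sum_pmf UNIV_bool)

lemma integrable_bernoulli_sum_pmf:
  fixes f :: "nat \<Rightarrow> real"
  assumes "finite I"
  shows "integrable (measure_pmf (bernoulli_sum_pmf I p)) f"
  using assms by (simp add: integrable_measure_pmf_finite finite_set_bernoulli_sum_pmf)

lemma prob_sum_less_expectation:
  "prob_sum_less I p k = measure_pmf.expectation (bernoulli_sum_pmf I p) (\<lambda>s. of_bool (s < k))"
proof -
  have "(\<lambda>s. of_bool (s < k) :: real) = indicator {s. s < k}"
    by (auto simp: indicator_def)
  then show ?thesis
    by (simp add: prob_sum_less_def)
qed

text \<open>A further success raises \<open>min s k\<close> by one exactly when
  \<open>s < k\<close>, and it is independent of \<open>s\<close>.\<close>

lemma expect_min_sum_insert: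
  assumes "finite I" "i \<notin> I" "p i \<in> {0..1}"
  shows "expect_min_sum (insert i I) p k = expect_min_sum I p k + p i * prob_sum_less I p k"
proof -
  have "(\<lambda>s. real (min (Suc s) k)) = (\<lambda>s. real (min s k) + of_bool (s < k))"
    by auto
  then show ?thesis
    unfolding expect_min_sum_def prob_sum_less_expectation
      expectation_bernoulli_sum_insert[where p = p, OF assms]
    using assms(1) by (simp add: integrable_bernoulli_sum_pmf algebra_simps del: of_nat_min)
qed

text \<open>With \<open>t = k - l\<close> this is the state recursion of the policy polytope. The
  case \<open>t = 0\<close> guards against truncated subtraction.\<close>

lemma pmf_bernoulli_sum_insert:
  assumes "finite I" "i \<notin> I" "p i \<in> {0..1}"
  shows "pmf (bernoulli_sum_pmf (insert i I) p) t =
    (1 - p i) * pmf (bernoulli_sum_pmf I p) t +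
    (if t = 0 then 0 else p i * pmf (bernoulli_sum_pmf I p) (t - 1))"
proof -
  have expect: "pmf M t = measure_pmf.expectation M (indicator {t})" for M :: "nat pmf" and t
    by (simp add: pmf.rep_eq)
  have "(\<lambda>s. indicator {t} (Suc s) :: real) = (if t = 0 then (\<lambda>_. 0) else indicator {t - 1})"
    by (auto simp: indicator_def fun_eq_iff)
  then show ?thesis
    using expectation_bernoulli_sum_insert[where p = p, OF assms, of "indicator {t}"] by (auto simp: expect)
qed

lemma prob_sum_less_nonneg [simp]: "0 \<le> prob_sum_less I p k"
  and prob_sum_less_le_1 [simp]: "prob_sum_less I p k \<le> 1"
  by (simp_all add: prob_sum_less_def)

lemma prob_sum_less_insert_le:
  assumes "finite I" "p i \<in> {0..1}"
  shows "prob_sum_less (insert i I) p k \<le> prob_sum_less I p k"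
proof (cases "i \<in> I")
  case False
  let ?E = "measure_pmf.expectation (bernoulli_sum_pmf I p) :: (nat \<Rightarrow> real) \<Rightarrow> real"
  have "?E (\<lambda>s. of_bool (Suc s < k)) \<le> ?E (\<lambda>s. of_bool (s < k))"
    using assms(1) by (intro Bochner_Integration.integral_mono integrable_bernoulli_sum_pmf) auto
  then show ?thesis
    using mult_left_mono[of _ _ "p i"] assms False
    unfolding prob_sum_less_expectation
    by (fastforce simp: expectation_bernoulli_sum_insert algebra_simps)
qed (simp add: insert_absorb)

lemma prob_sum_less_antimono:
  assumes "finite K" "I \<subseteq> K" "\<forall>i\<in>K. p i \<in> {0..1}"
  shows "prob_sum_less K p k \<le> prob_sum_less I p k"
proof -
  \<comment> \<open>Adding indices one at a time; \<open>L\<close> may overlap \<open>I\<close>,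
    since inserting an element already present changes nothing.\<close>
  have "prob_sum_less (I \<union> L) p k \<le> prob_sum_less I p k" if "finite L" "L \<subseteq> K" for L
    using that
  proof (induction L)
    case (insert a L)
    have "prob_sum_less (insert a (I \<union> L)) p k \<le> prob_sum_less (I \<union> L) p k"
      using insert assms by (intro prob_sum_less_insert_le) (auto intro: finite_subset)
    with insert show ?case
      by auto
  qed simp
  from this[of K] show ?thesis
    using assms by (simp add: Un_absorb1)
qed

lemma prob_sum_less_eq_sum_pmf:
  "prob_sum_less I p k = (\<Sum>l=1..k. pmf (bernoulli_sum_pmf I p) (k - l))"
proof -
  have "prob_sum_less I p k = (\<Sum>s<k. pmf (bernoulli_sum_pmf I p) s)"
    unfolding prob_sum_less_def
    by (subst measure_measure_pmf_finite) (auto simp: lessThan_def)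
  also have "\<dots> = (\<Sum>l=1..k. pmf (bernoulli_sum_pmf I p) (k - l))"
    by (rule sum.reindex_bij_witness[of _ "\<lambda>l. k - l" "\<lambda>s. k - s"]) auto
  finally show ?thesis .
qed

lemma expect_min_sum_nonneg [simp]: "0 \<le> expect_min_sum I p k"
  by (simp add: expect_min_sum_def)

lemma expect_min_sum_le:
  assumes "finite I"
  shows "expect_min_sum I p k \<le> real k"
  unfolding expect_min_sum_def
  using assms by (intro measure_pmf.integral_le_const integrable_bernoulli_sum_pmf) auto

lemma expect_min_sum_le_sum:
  assumes "finite I" "\<forall>i\<in>I. p i \<in> {0..1}"
  shows "expect_min_sum I p k \<le> sum p I"
  using assms
proof (induction I)
  case (insert i I)
  then have "p i * prob_sum_less I p k \<le> p i"
    by (intro mult_left_le) auto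
  with insert show ?case
    by (simp add: expect_min_sum_insert)
qed (simp add: expect_min_sum_def)

text \<open>Agent by agent, the capped sum grows only while capacity remains, so the policy's
  expected number of acceptances is the mean of the capped sum.\<close>

lemma expect_min_sum_eq_sum:
  assumes "\<forall>i\<in>{1..n}. p i \<in> {0..1}"
  shows "expect_min_sum {1..n} p k = (\<Sum>i=1..n. p i * prob_sum_less {1..<i} p k)"
  using assms
proof (induction n)
  case (Suc n)
  then have "expect_min_sum {1..Suc n} p k =
      expect_min_sum {1..n} p k + p (Suc n) * prob_sum_less {1..n} p k"
    by (subst atLeastAtMostSuc_conv) (auto simp: expect_min_sum_insert)
  with Suc show ?case
    by (simp add: atLeastLessThanSuc_atLeastAtMost)
qed (simp add: expect_min_sum_def)

lemma bernoulli_sum_pmf_const_1: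
  assumes "finite I" "\<forall>i\<in>I. p i = 1"
  shows "bernoulli_sum_pmf I p = return_pmf (card I)"
proof -
  have bern: "bernoulli_pmf 1 = return_pmf True"
    by (rule pmf_eqI) (auto simp: indicator_def elim: bool.exhaust)
  show ?thesis
    using assms
    by (induction I rule: finite_induct) (auto simp: bernoulli_sum_pmf_insert bind_return_pmf bern)
qed

lemma bernoulli_sum_pmf_const_0:
  assumes "finite I" "\<forall>i\<in>I. p i = 0"
  shows "bernoulli_sum_pmf I p = return_pmf 0"
proof -
  have bern: "bernoulli_pmf 0 = return_pmf False"
    by (rule pmf_eqI) (auto simp: indicator_def elim: bool.exhaust)
  show ?thesis
    using assms
    by (induction I rule: finite_induct) (auto simp: bernoulli_sum_pmf_insert bind_return_pmf bern)
qed


section \<open>The inner linear program of a static threshold policy\<close>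

lemma atLeastLessThan_insert_last: "Suc 0 \<le> i \<Longrightarrow> {1..<Suc i} = insert i {1..<i}"
  by auto

text \<open>Here \<open>l\<close> is the remaining capacity and \<open>k - l\<close> the number of
  acceptances so far. Substituting \<open>y = p x\<close> turns the polytope recursion into that of
  the Bernoulli sum.\<close>

lemma policy_polytope_state_eq:
  assumes "(x, y) \<in> policy_polytope k n"
    and "\<forall>i\<in>{1..n}. \<forall>l\<in>{1..k}. y l i = p i * x l i"
    and "\<forall>i\<in>{1..n}. p i \<in> {0..1}"
    and "i \<in> {1..n}" "l \<in> {1..k}"
  shows "x l i = pmf (bernoulli_sum_pmf {1..<i} p) (k - l)"
  using assms(4,5)
proof (induction i arbitrary: l)
  case (Suc i)
  show ?case
  proof (cases "i = 0")
    case True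
    then show ?thesis
      \<comment> \<open>Before the first agent the sum is empty, and its point mass at 0 corresponds
        to \<open>l = k\<close>.\<close>
      using assms(1) Suc.prems unfolding policy_polytope_def
      by (cases "l = k") auto
  next
    case False
    have "x l (Suc i) = x l i - y l i + (if l < k then y (l + 1) i else 0)"
      using assms(1) False Suc.prems unfolding policy_polytope_def by force
    also have "\<dots> = (1 - p i) * x l i + (if l < k then p i * x (l + 1) i else 0)"
      using assms(2) Suc.prems False by (auto simp: algebra_simps)
    also have "\<dots> = (1 - p i) * pmf (bernoulli_sum_pmf {1..<i} p) (k - l) +
        (if l < k then p i * pmf (bernoulli_sum_pmf {1..<i} p) (k - (l + 1)) else 0)"
      using Suc False by auto
    \<comment> \<open>For \<open>l = k\<close> the convention on \<open>y\<close> at level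
      \<open>k + 1\<close> matches the missing term at 0; otherwise \<open>k - (l + 1)\<close> is
      the predecessor of \<open>k - l\<close>.\<close>
    also have "\<dots> = pmf (bernoulli_sum_pmf {1..<Suc i} p) (k - l)"
      using assms(3) Suc.prems False
      by (subst atLeastLessThan_insert_last)
        (auto simp: pmf_bernoulli_sum_insert Suc_diff_Suc)
    finally show ?thesis .
  qed
qed simp

lemma policy_polytope_exists:
  assumes "k \<ge> 1" "\<forall>i\<in>{1..n}. p i \<in> {0..1}"
  shows "\<exists>(x, y)\<in>policy_polytope k n. \<forall>i\<in>{1..n}. \<forall>l\<in>{1..k}. y l i = p i * x l i"
proof -
  define x where "x = (\<lambda>l i. pmf (bernoulli_sum_pmf {1..<i} p) (k - l))"
  define y where "y = (\<lambda>l i. p i * x l i)"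
  have "x l i = x l (i - 1) - y l (i - 1) + (if l < k then y (l + 1) (i - 1) else 0)"
    if il: "i \<in> {2..n}" "l \<in> {1..k}" for i l
  proof -
    have "i - 1 \<in> {1..n}"
      using il by auto
    then have "{1..<i} = insert (i - 1) {1..<i - 1}" "p (i - 1) \<in> {0..1}"
      using assms(2) by (auto simp del: One_nat_def)
    then show ?thesis
      using il by (auto simp: x_def y_def pmf_bernoulli_sum_insert algebra_simps)
  qed
  moreover have "0 \<le> y l i \<and> y l i \<le> x l i" if "i \<in> {1..n}" for i l
    using assms(2) that by (auto simp: x_def y_def mult_left_le_one_le)
  ultimately have "(x, y) \<in> policy_polytope k n"
    unfolding policy_polytope_def by (auto simp: x_def)
  then show ?thesis
    by (auto simp: y_def)
qed

text \<open>A convex combination lies between its ends. Hence \<open>min (p i) (G i j)\<close> is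
  \<open>p i\<close> for \<open>j \<ge> J\<close> and \<open>G i j\<close> for
  \<open>j < J\<close>.\<close>

lemma ost_prob_bounds:
  assumes "(m, G) \<in> type_dists n" "J \<in> {1..m}" "\<rho> \<in> {0<..1}" "i \<in> {1..n}"
  shows "G i (J - 1) \<le> ost_prob G J \<rho> i" "ost_prob G J \<rho> i \<le> G i J"
proof -
  have "\<forall>j<m. G i j \<le> G i (Suc j)"
    using assms by (auto simp: type_dists_def)
  then have "G i (J - 1) \<le> G i J"
    using assms(2) by (auto dest: spec[of _ "J - 1"])
  then have "0 \<le> \<rho> * (G i J - G i (J - 1))" "0 \<le> (1 - \<rho>) * (G i J - G i (J - 1))"
    using assms(2,3) by auto
  then show "G i (J - 1) \<le> ost_prob G J \<rho> i" "ost_prob G J \<rho> i \<le> G i J"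
    by (auto simp: ost_prob_def algebra_simps)
qed

lemma type_dists_mono:
  assumes "(m, G) \<in> type_dists n" "i \<in> {1..n}" "j \<le> j'" "j' \<le> m"
  shows "G i j \<le> G i j'"
  using assms(3,4)
proof (induction j' rule: dec_induct)
  case (step j')
  then have "G i j' \<le> G i (Suc j')"
    using assms(1,2) by (auto simp: type_dists_def)
  with step show ?case
    by simp
qed simp

lemma type_dists_bounds:
  assumes "(m, G) \<in> type_dists n" "i \<in> {1..n}" "j \<le> m"
  shows "G i j \<in> {0..1}"
  using type_dists_mono[OF assms(1,2), of 0 j] type_dists_mono[OF assms(1,2), of j m] assms
  by (auto simp: type_dists_def)

lemma ost_prob_in_unit:
  assumes "(m, G) \<in> type_dists n" "J \<in> {1..m}" "\<rho> \<in> {0<..1}"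
  shows "\<forall>i\<in>{1..n}. ost_prob G J \<rho> i \<in> {0..1}"
proof
  fix i assume i: "i \<in> {1..n}"
  have "G i (J - 1) \<in> {0..1}" "G i J \<in> {0..1}"
    using type_dists_bounds[OF assms(1) i] assms(2) by auto
  then show "ost_prob G J \<rho> i \<in> {0..1}"
    using ost_prob_bounds[OF assms i] by auto
qed

text \<open>The constraints \<open>y = p x\<close> leave a single point of the polytope, in which \<open>x l i\<close> is the
  probability that \<open>k - l\<close> of the agents before \<open>i\<close> have been accepted.\<close>

lemma innerLP_OST_eq:
  fixes Q :: "nat \<Rightarrow> real"
  assumes "k \<ge> 1" "(m, G) \<in> type_dists n" "J \<in> {1..m}" "\<rho> \<in> {0<..1}"
  defines "p \<equiv> ost_prob G J \<rho>"
  shows "innerLP_OST Q k n m G J \<rho> = Sup {ereal \<theta> |\<theta>. \<forall>j\<in>{1..m}.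
    \<theta> * Q j \<le> (\<Sum>i=1..n. min (p i) (G i j) * prob_sum_less {1..<i} p k)}"
proof -
  have p: "\<forall>i\<in>{1..n}. p i \<in> {0..1}"
    using ost_prob_in_unit[OF assms(2-4)] by (simp add: p_def)
  \<comment> \<open>The factor \<open>x l i\<close> leaves the minimum; summed over \<open>l\<close>
    it gives the probability that agent \<open>i\<close> finds capacity.\<close>
  have reward: "(\<Sum>i=1..n. \<Sum>l=1..k. min (y l i) (G i j * x l i)) =
      (\<Sum>i=1..n. min (p i) (G i j) * prob_sum_less {1..<i} p k)"
    if xy: "(x, y) \<in> policy_polytope k n" "\<forall>i\<in>{1..n}. \<forall>l\<in>{1..k}. y l i = p i * x l i"
    for x y j
  proof (rule sum.cong[OF refl])
    fix i assume i: "i \<in> {1..n}"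
    have "min (y l i) (G i j * x l i) =
        min (p i) (G i j) * pmf (bernoulli_sum_pmf {1..<i} p) (k - l)" if l: "l \<in> {1..k}" for l
      using policy_polytope_state_eq[OF xy p i l] xy(2) i l
      by (simp add: min_mult_distrib_right)
    then show "(\<Sum>l=1..k. min (y l i) (G i j * x l i)) =
        min (p i) (G i j) * prob_sum_less {1..<i} p k"
      by (simp add: prob_sum_less_eq_sum_pmf sum_distrib_left)
  qed
  have "(\<exists>(x, y)\<in>policy_polytope k n.
      (\<forall>j\<in>{1..m}. \<theta> * Q j \<le> (\<Sum>i=1..n. \<Sum>l=1..k. min (y l i) (G i j * x l i))) \<and>
      (\<forall>i\<in>{1..n}. \<forall>l\<in>{1..k}. y l i = p i * x l i)) \<longleftrightarrow>
    (\<forall>j\<in>{1..m}. \<theta> * Q j \<le> (\<Sum>i=1..n. min (p i) (G i j) * prob_sum_less {1..<i} p k))" for \<theta>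
  proof -
    obtain x y where "(x, y) \<in> policy_polytope k n"
        "\<forall>i\<in>{1..n}. \<forall>l\<in>{1..k}. y l i = p i * x l i"
      using policy_polytope_exists[OF assms(1) p] by blast
    with reward show ?thesis
      by (intro iffI) (auto simp del: One_nat_def intro!: bexI[of _ "(x, y)"])
  qed
  then show ?thesis
    unfolding innerLP_OST_def p_def by simp
qed

text \<open>The explicit minimum is itself a feasible \<open>\<theta>\<close>. The benchmark is an
  abstract \<open>\<Phi>\<close>, so that one argument serves both linear programs.\<close>

lemma innerLP_OST_ge:
  fixes \<Phi> :: "(nat \<Rightarrow> real) \<Rightarrow> real"
  assumes "k \<ge> 1" "n > k" "(m, G) \<in> type_dists n" "J \<in> {1..m}" "\<rho> \<in> {0<..1}"
    and \<Phi>: "\<And>q. (\<forall>i\<in>{1..n}. q i \<in> {0..1}) \<Longrightarrow> \<Phi> q \<le> min (sum q {1..n}) (real k)"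
  defines "p \<equiv> ost_prob G J \<rho>"
  shows "ereal (min (prob_sum_less {1..<n} p k) (expect_min_sum {1..<n} p k / real k))
    \<le> innerLP_OST (\<lambda>j. \<Phi> (\<lambda>i. G i j)) k n m G J \<rho>"
proof -
  define \<theta> where "\<theta> = min (prob_sum_less {1..<n} p k) (expect_min_sum {1..<n} p k / real k)"
  have p: "\<forall>i\<in>{1..n}. p i \<in> {0..1}"
    using ost_prob_in_unit[OF assms(3-5)] by (simp add: p_def)
  have \<theta>: "0 \<le> \<theta>" "\<theta> \<le> prob_sum_less {1..<n} p k" "\<theta> * real k \<le> expect_min_sum {1..<n} p k"
    using assms(1) by (auto simp: \<theta>_def min_le_iff_disj pos_le_divide_eq[symmetric])
  have "\<theta> * \<Phi> (\<lambda>i. G i j) \<le> (\<Sum>i=1..n. min (p i) (G i j) * prob_sum_less {1..<i} p k)"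
    if j: "j \<in> {1..m}" for j
  proof -
    have G: "G i j \<in> {0..1}" if "i \<in> {1..n}" for i
      using type_dists_bounds[OF assms(3) that] j by auto
    then have \<Phi>j: "\<Phi> (\<lambda>i. G i j) \<le> (\<Sum>i=1..n. G i j)" "\<Phi> (\<lambda>i. G i j) \<le> real k"
      using \<Phi>[of "\<lambda>i. G i j"] by auto
    show ?thesis
    proof (cases "J \<le> j")
      case True
      have "min (p i) (G i j) = p i" if "i \<in> {1..n}" for i
        using ost_prob_bounds(2)[OF assms(3-5) that] type_dists_mono[OF assms(3) that True] j
        by (auto simp: p_def)
      then have "(\<Sum>i=1..n. min (p i) (G i j) * prob_sum_less {1..<i} p k) =
          expect_min_sum {1..n} p k"
        unfolding expect_min_sum_eq_sum[OF p] by (intro sum.cong) auto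
      also have "\<dots> = expect_min_sum {1..<n} p k + p n * prob_sum_less {1..<n} p k"
        using assms(1,2) p by (subst expect_min_sum_insert[symmetric])
          (auto intro!: arg_cong[of _ _ "\<lambda>I. expect_min_sum I p k"])
      \<comment> \<open>Agent \<open>n\<close> contributes a nonnegative amount, which is
        dropped.\<close>
      also have "\<dots> \<ge> expect_min_sum {1..<n} p k"
        using p assms(1,2) by auto
      finally show ?thesis
        using \<theta>(3) mult_left_mono[OF \<Phi>j(2) \<theta>(1)] by linarith
    next
      case False
      \<comment> \<open>Termwise: the reward coefficient is \<open>G i j\<close>, and capacity is at
        least as likely to remain for agent \<open>i\<close> as for agent \<open>n\<close>.\<close>
      have "\<theta> * G i j \<le> min (p i) (G i j) * prob_sum_less {1..<i} p k" if i: "i \<in> {1..n}" for i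
      proof -
        have "G i j \<le> G i (J - 1)"
          using type_dists_mono[OF assms(3) i, of j "J - 1"] False assms(4) by auto
        then have "min (p i) (G i j) = G i j"
          using ost_prob_bounds(1)[OF assms(3-5) i] by (auto simp: p_def)
        moreover have "prob_sum_less {1..<n} p k \<le> prob_sum_less {1..<i} p k"
          using i p by (intro prob_sum_less_antimono) auto
        ultimately show ?thesis
          using \<theta>(2) G[OF i] mult_left_mono[of \<theta> "prob_sum_less {1..<i} p k" "G i j"]
          by (simp add: mult.commute)
      qed
      then have "\<theta> * (\<Sum>i=1..n. G i j) \<le>
          (\<Sum>i=1..n. min (p i) (G i j) * prob_sum_less {1..<i} p k)"
        unfolding sum_distrib_left by (rule sum_mono)
      then show ?thesis
        using mult_left_mono[OF \<Phi>j(1) \<theta>(1)] by linarith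
    qed
  qed
  then show ?thesis
    unfolding innerLP_OST_eq[OF assms(1,3-5)] p_def[symmetric] \<theta>_def[symmetric]
    by (intro Sup_upper) auto
qed


section \<open>The hard instances\<close>

text \<open>Agent \<open>n\<close> has the best type with probability \<open>\<epsilon>\<close> and otherwise a type worse than all others;
  the remaining agents follow \<open>G\<close>.\<close>

definition hard_dist :: "nat \<Rightarrow> nat \<Rightarrow> real \<Rightarrow> (nat \<Rightarrow> nat \<Rightarrow> real) \<Rightarrow> nat \<Rightarrow> nat \<Rightarrow> real" where
  "hard_dist n m \<epsilon> G i j =
     (if j = 0 then 0 else if j = m + 2 then 1 else if i = n then \<epsilon> else G i (j - 1))"

text \<open>Columns 1 to \<open>m + 1\<close> are columns 0 to \<open>m\<close> of \<open>G\<close>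
  except for agent \<open>n\<close>; monotonicity across the two added ends uses
  \<open>G i 0 = 0\<close> and \<open>G i m = 1\<close>.\<close>

lemma hard_dist_in_type_dists:
  assumes "(m, G) \<in> type_dists n" "0 < \<epsilon>" "\<epsilon> \<le> 1"
  shows "(m + 2, hard_dist n m \<epsilon> G) \<in> type_dists n"
proof -
  have "hard_dist n m \<epsilon> G i j \<le> hard_dist n m \<epsilon> G i (Suc j)" if "i \<in> {1..n}" "j < m + 2" for i j
    using that assms type_dists_mono[OF assms(1) that(1), of "j - 1" j]
      type_dists_bounds[OF assms(1) that(1), of m] type_dists_bounds[OF assms(1) that(1), of 0]
    by (cases "j = m + 1") (auto simp: hard_dist_def type_dists_def)
  then show ?thesis
    by (simp add: type_dists_def hard_dist_def)
qed

text \<open>An interior threshold \<open>J\<close> acts on the agents before \<open>n\<close> as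
  threshold \<open>J - 1\<close> of \<open>G\<close>; each of the two extreme thresholds yields at
  most \<open>\<epsilon>\<close>. The conditions on \<open>\<Phi>\<close> evaluate it on the first
  and last columns.\<close>

lemma innerLP_OST_hard_dist_le:
  fixes \<Phi> :: "(nat \<Rightarrow> real) \<Rightarrow> real"
  assumes k: "k \<ge> 1" "n > k" and G: "(m, G) \<in> type_dists n" and \<epsilon>: "0 < \<epsilon>" "\<epsilon> \<le> 1"
    and J: "J \<in> {1..m + 2}" and \<rho>: "\<rho> \<in> {0<..1}"
    and \<Phi>_last: "\<And>q. (\<forall>i\<in>{1..<n}. q i = 0) \<Longrightarrow> q n = \<epsilon> \<Longrightarrow> \<Phi> q = \<epsilon>"
    and \<Phi>_ones: "\<And>q. (\<forall>i\<in>{1..n}. q i = 1) \<Longrightarrow> \<Phi> q = real k"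
  defines "H \<equiv> hard_dist n m \<epsilon> G"
  shows "innerLP_OST (\<lambda>j. \<Phi> (\<lambda>i. H i j)) k n (m + 2) H J \<rho> \<le>
    (SUP (J, \<rho>)\<in>{1..m} \<times> {0<..1}. ereal (min (prob_sum_less {1..<n} (ost_prob G J \<rho>) k)
                       (expect_min_sum {1..<n} (ost_prob G J \<rho>) k / real k))) + ereal \<epsilon>"
    (is "_ \<le> ?S + _")
proof -
  let ?R = "\<lambda>p. min (prob_sum_less {1..<n} p k) (expect_min_sum {1..<n} p k / real k)"
  define p where "p = ost_prob H J \<rho>"
  have m: "m \<ge> 1"
    using G by (simp add: type_dists_def)
  have H: "(m + 2, H) \<in> type_dists n"
    unfolding H_def using G \<epsilon> by (rule hard_dist_in_type_dists)
  have p: "\<forall>i\<in>{1..n}. p i \<in> {0..1}"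
    using ost_prob_in_unit[OF H J \<rho>] by (simp add: p_def)
  have S: "ereal (?R (ost_prob G J' \<rho>')) \<le> ?S" if "J' \<in> {1..m}" "\<rho>' \<in> {0<..1}" for J' \<rho>'
    using that by (intro SUP_upper2[of "(J', \<rho>')"]) auto
  \<comment> \<open>As \<open>m \<ge> 1\<close>, the supremum is over a nonempty set of nonnegative
    values; with this, \<open>\<theta> \<le> \<epsilon>\<close> suffices for the extreme
    thresholds.\<close>
  have S_nonneg: "0 \<le> ?S"
    using m by (intro order_trans[OF _ S[of 1 1]]) auto
  have "ereal \<theta> \<le> ?S + ereal \<epsilon>"
    if \<theta>: "\<forall>j\<in>{1..m + 2}. \<theta> * \<Phi> (\<lambda>i. H i j) \<le>
      (\<Sum>i=1..n. min (p i) (H i j) * prob_sum_less {1..<i} p k)" for \<theta>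
  proof -
    have "\<Phi> (\<lambda>i. H i (m + 2)) = real k"
      by (intro \<Phi>_ones) (simp add: H_def hard_dist_def)
    moreover have "(\<Sum>i=1..n. min (p i) (H i (m + 2)) * prob_sum_less {1..<i} p k) =
        expect_min_sum {1..n} p k"
      using p by (subst expect_min_sum_eq_sum) (auto simp: H_def hard_dist_def intro!: sum.cong)
    ultimately have \<theta>_le: "\<theta> * real k \<le> expect_min_sum {1..n} p k"
      using bspec[OF \<theta>, of "m + 2"] by simp
    \<comment> \<open>Column 1 vanishes except for \<open>\<epsilon>\<close> at agent
      \<open>n\<close>, so its constraint yields \<open>\<theta> * \<epsilon> \<le> \<epsilon> *
      prob_sum_less {1..<n} p k\<close>.\<close>
    have \<theta>_prob: "\<theta> \<le> prob_sum_less {1..<n} p k" if "J \<noteq> 1"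
    proof -
      have H1: "H i 1 = (if i = n then \<epsilon> else 0)" if "i \<in> {1..n}" for i
        using G that m by (auto simp: H_def hard_dist_def type_dists_def)
      have "(\<Sum>i=1..n. min (p i) (H i 1) * prob_sum_less {1..<i} p k) \<le>
          (\<Sum>i=1..n. H i 1 * prob_sum_less {1..<i} p k)"
        by (intro sum_mono mult_right_mono) auto
      also have "\<dots> = (\<Sum>i=1..n. if i = n then \<epsilon> * prob_sum_less {1..<n} p k else 0)"
        by (intro sum.cong) (auto simp: H1 simp del: One_nat_def)
      also have "\<dots> = \<epsilon> * prob_sum_less {1..<n} p k"
        using k by simp
      finally have "\<theta> * \<epsilon> \<le> \<epsilon> * prob_sum_less {1..<n} p k"
        using bspec[OF \<theta>, of 1] \<Phi>_last[of "\<lambda>i. H i 1"] H1 k by simp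
      then show ?thesis
        using \<epsilon> by (simp add: mult.commute)
    qed
    consider "J = 1" | "J = m + 2" | "J \<in> {2..m + 1}"
      using J by fastforce
    then show ?thesis
    proof cases
      case 1
      \<comment> \<open>Columns 0 and 1 are mixed, so only agent \<open>n\<close> is ever
        accepted.\<close>
      have "p i = (if i = n then \<rho> * \<epsilon> else 0)" if "i \<in> {1..n}" for i
        using 1 G that m by (auto simp: p_def ost_prob_def H_def hard_dist_def type_dists_def)
      then have "sum p {1..n} = (\<Sum>i=1..n. if i = n then \<rho> * \<epsilon> else 0)"
        by (intro sum.cong) auto
      also have "\<dots> \<le> \<epsilon>"
        using k \<rho> \<epsilon> by (simp add: mult_left_le_one_le)
      finally have "\<theta> * real k \<le> \<epsilon>"
        using \<theta>_le expect_min_sum_le_sum[OF _ p, of k] by simp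
      also have "\<epsilon> \<le> \<epsilon> * real k"
        using k \<epsilon> by simp
      finally have "\<theta> \<le> \<epsilon>"
        using k by simp
      then show ?thesis
        using add_mono[OF S_nonneg, of "ereal \<theta>" "ereal \<epsilon>"] by simp
    next
      case 2
      \<comment> \<open>Both mixed columns equal 1 before agent \<open>n\<close>, and
        \<open>n - 1 \<ge> k\<close> sure acceptances exhaust the capacity.\<close>
      have "\<forall>i\<in>{1..<n}. p i = 1"
        using 2 G m by (auto simp: p_def ost_prob_def H_def hard_dist_def type_dists_def)
      then have "prob_sum_less {1..<n} p k = 0"
        using k by (simp add: prob_sum_less_def bernoulli_sum_pmf_const_1)
      then have "\<theta> \<le> \<epsilon>"
        using \<theta>_prob 2 \<epsilon> by simp
      then show ?thesis
        using add_mono[OF S_nonneg, of "ereal \<theta>" "ereal \<epsilon>"] by simp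
    next
      case 3
      define q where "q = ost_prob G (J - 1) \<rho>"
      have "\<forall>i\<in>{1..<n}. p i = q i"
        using 3 G by (auto simp: p_def q_def ost_prob_def H_def hard_dist_def type_dists_def)
      then have "bernoulli_sum_pmf {1..<n} p = bernoulli_sum_pmf {1..<n} q"
        by (intro bernoulli_sum_pmf_cong) auto
      then have law: "prob_sum_less {1..<n} p k = prob_sum_less {1..<n} q k"
          "expect_min_sum {1..<n} p k = expect_min_sum {1..<n} q k"
        by (simp_all only: prob_sum_less_def expect_min_sum_def)
      \<comment> \<open>Both mixed columns hold \<open>\<epsilon>\<close> for agent
        \<open>n\<close>, whatever \<open>\<rho>\<close> is.\<close>
      have pn: "p n = \<epsilon>"
        using 3 by (auto simp: p_def ost_prob_def H_def hard_dist_def algebra_simps)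
      have "{1..n} = insert n {1..<n}"
        using k by auto
      then have "expect_min_sum {1..n} p k =
          expect_min_sum {1..<n} p k + \<epsilon> * prob_sum_less {1..<n} p k"
        using pn \<epsilon> by (simp add: expect_min_sum_insert)
      also have "\<dots> \<le> expect_min_sum {1..<n} p k + \<epsilon> * real k"
        using \<epsilon> k order_trans[OF prob_sum_less_le_1] by (intro add_left_mono mult_left_mono) auto
      finally have "\<theta> \<le> expect_min_sum {1..<n} p k / real k + \<epsilon>"
        using \<theta>_le k by (simp add: field_simps)
      moreover have "\<theta> \<le> prob_sum_less {1..<n} p k + \<epsilon>"
        using \<theta>_prob 3 \<epsilon> by auto
      ultimately have "\<theta> \<le> ?R q + \<epsilon>"
        unfolding law by linarith
      then have "ereal \<theta> \<le> ereal (?R q) + ereal \<epsilon>"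
        by (simp only: plus_ereal.simps ereal_less_eq)
      also have "\<dots> \<le> ?S + ereal \<epsilon>"
        unfolding q_def using 3 \<rho> by (intro add_right_mono S) auto
      finally show ?thesis .
    qed
  qed
  then show ?thesis
    unfolding innerLP_OST_eq[OF k(1) H J \<rho>] p_def[symmetric] by (intro Sup_least) auto
qed

text \<open>One direction compares the two sides instance by instance; the other perturbs each
  \<open>G\<close> into a hard instance and lets the error tend to 0.\<close>

lemma INF_innerLP_OST_eq:
  fixes \<Phi> :: "(nat \<Rightarrow> real) \<Rightarrow> real"
  assumes k: "k \<ge> 1" "n > k"
    and \<Phi>_le: "\<And>q. (\<forall>i\<in>{1..n}. q i \<in> {0..1}) \<Longrightarrow> \<Phi> q \<le> min (sum q {1..n}) (real k)"
    and \<Phi>_last: "\<And>\<epsilon> q. 0 < \<epsilon> \<Longrightarrow> \<epsilon> \<le> 1 \<Longrightarrow> (\<forall>i\<in>{1..<n}. q i = 0) \<Longrightarrow> q n = \<epsilon> \<Longrightarrow> \<Phi> q = \<epsilon>"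
    and \<Phi>_ones: "\<And>q. (\<forall>i\<in>{1..n}. q i = 1) \<Longrightarrow> \<Phi> q = real k"
  shows "(INF (m, G)\<in>type_dists n. SUP (J, \<rho>)\<in>{1..m} \<times> {0<..1}.
            innerLP_OST (\<lambda>j. \<Phi> (\<lambda>i. G i j)) k n m G J \<rho>)
       = (INF (m, G)\<in>type_dists n. SUP (J, \<rho>)\<in>{1..m} \<times> {0<..1}.
            ereal (min (prob_sum_less {1..<n} (ost_prob G J \<rho>) k)
                       (expect_min_sum {1..<n} (ost_prob G J \<rho>) k / real k)))"
    (is "(INF (m, G)\<in>_. ?L m G) = (INF (m, G)\<in>_. ?R m G)")
proof (rule antisym)
  show "(INF (m, G)\<in>type_dists n. ?L m G) \<le> (INF (m, G)\<in>type_dists n. ?R m G)"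
  proof (rule INF_greatest, unfold split_paired_all prod.case, rule ereal_le_epsilon2)
    fix m G and e :: real assume G: "(m, G) \<in> type_dists n" and "0 < e"
    \<comment> \<open>Capped at 1 to be a probability.\<close>
    define \<epsilon> where "\<epsilon> = min e 1"
    have \<epsilon>: "0 < \<epsilon>" "\<epsilon> \<le> 1" "\<epsilon> \<le> e"
      using \<open>0 < e\<close> by (auto simp: \<epsilon>_def)
    define H where "H = hard_dist n m \<epsilon> G"
    have "(INF (m, G)\<in>type_dists n. ?L m G) \<le> ?L (m + 2) H"
      using hard_dist_in_type_dists[OF G \<epsilon>(1,2)]
      by (intro INF_lower2[of "(m + 2, H)"]) (auto simp: H_def)
    also have "\<dots> \<le> ?R m G + ereal \<epsilon>"
      unfolding H_def
      by (rule SUP_least, unfold split_paired_all prod.case mem_Times_iff fst_conv snd_conv)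
        (intro innerLP_OST_hard_dist_le[OF k G \<epsilon>(1,2)] \<Phi>_last[OF \<epsilon>(1,2)] \<Phi>_ones; simp)
    also have "\<dots> \<le> ?R m G + ereal e"
      using \<epsilon> by (intro add_left_mono) simp
    finally show "(INF (m, G)\<in>type_dists n. ?L m G) \<le> ?R m G + ereal e" .
  qed
  show "(INF (m, G)\<in>type_dists n. ?R m G) \<le> (INF (m, G)\<in>type_dists n. ?L m G)"
  proof (rule INF_superset_mono[OF order_refl], unfold split_paired_all prod.case)
    fix m G assume G: "(m, G) \<in> type_dists n"
    show "?R m G \<le> ?L m G"
      by (rule SUP_subset_mono[OF order_refl],
          unfold split_paired_all prod.case mem_Times_iff fst_conv snd_conv)
        (intro innerLP_OST_ge[OF k G] \<Phi>_le; simp)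
  qed
qed

theorem theorem5:
  fixes k n :: nat
  assumes "k \<ge> 1" and "n > k"
  shows "(INF (m, G)\<in>type_dists n. SUP (J, \<rho>)\<in>{1..m} \<times> {0<..1}. innerLP_OST_Proph k n m G J \<rho>)
       = (INF (m, G)\<in>type_dists n. SUP (J, \<rho>)\<in>{1..m} \<times> {0<..1}. innerLP_OST_ExAnte k n m G J \<rho>)
     \<and> (INF (m, G)\<in>type_dists n. SUP (J, \<rho>)\<in>{1..m} \<times> {0<..1}. innerLP_OST_ExAnte k n m G J \<rho>)
       = (INF (m, G)\<in>type_dists n. SUP (J, \<rho>)\<in>{1..m} \<times> {0<..1}.
            ereal (min (prob_sum_less {1..<n} (ost_prob G J \<rho>) k)
                       (expect_min_sum {1..<n} (ost_prob G J \<rho>) k / real k)))"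
proof -
  have split: "{1..n} = insert n {1..<n}"
    using assms by auto
  \<comment> \<open>The sum is a single Bernoulli variable of mean \<open>\<epsilon>\<close>, which
    the cap \<open>k \<ge> 1\<close> leaves unchanged.\<close>
  have last: "expect_min_sum {1..n} q k = \<epsilon>"
    if "0 < \<epsilon>" "\<epsilon> \<le> 1" "\<forall>i\<in>{1..<n}. q i = 0" "q n = \<epsilon>" for \<epsilon> and q :: "nat \<Rightarrow> real"
    proof -
    have "expect_min_sum {1..n} q k = expect_min_sum {1..<n} q k + q n * prob_sum_less {1..<n} q k"
      unfolding split using that by (intro expect_min_sum_insert) auto
    then show ?thesis
      using that assms
      by (simp add: expect_min_sum_def prob_sum_less_def bernoulli_sum_pmf_const_0)
  qed
  have ones: "expect_min_sum {1..n} q k = real k" if "\<forall>i\<in>{1..n}. q i = 1" for q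
    using that assms by (simp add: expect_min_sum_def bernoulli_sum_pmf_const_1)
  have last': "min (sum q {1..n}) (real k) = \<epsilon>"
    if "0 < \<epsilon>" "\<epsilon> \<le> 1" "\<forall>i\<in>{1..<n}. q i = 0" "q n = \<epsilon>" for \<epsilon> and q :: "nat \<Rightarrow> real"
    using that assms unfolding split by simp
  have ones': "min (sum q {1..n}) (real k) = real k" if "\<forall>i\<in>{1..n}. q i = 1" for q :: "nat \<Rightarrow> real"
    using that assms by simp
  \<comment> \<open>The prophet benchmark never exceeds the ex-ante one, so both meet the upper
    bound asked of \<open>\<Phi>\<close>.\<close>
  have le: "expect_min_sum {1..n} q k \<le> min (sum q {1..n}) (real k)"
    if "\<forall>i\<in>{1..n}. q i \<in> {0..1}" for q
    using that by (simp add: expect_min_sum_le expect_min_sum_le_sum)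
  let ?R = "INF (m, G)\<in>type_dists n. SUP (J, \<rho>)\<in>{1..m} \<times> {0<..1}.
      ereal (min (prob_sum_less {1..<n} (ost_prob G J \<rho>) k)
                 (expect_min_sum {1..<n} (ost_prob G J \<rho>) k / real k))"
  have "(INF (m, G)\<in>type_dists n. SUP (J, \<rho>)\<in>{1..m} \<times> {0<..1}. innerLP_OST_Proph k n m G J \<rho>) = ?R"
    unfolding innerLP_OST_Proph_def
    by (rule INF_innerLP_OST_eq[where \<Phi> = "\<lambda>q. expect_min_sum {1..n} q k"])
      (fact assms | erule le | erule (3) last | erule ones)+
  moreover have "(INF (m, G)\<in>type_dists n. SUP (J, \<rho>)\<in>{1..m} \<times> {0<..1}.
      innerLP_OST_ExAnte k n m G J \<rho>) = ?R"
    unfolding innerLP_OST_ExAnte_def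
    by (rule INF_innerLP_OST_eq[where \<Phi> = "\<lambda>q. min (sum q {1..n}) (real k)"])
      (fact assms | rule order_refl | erule (3) last' | erule ones')+
  ultimately show ?thesis
    by (simp only:)
qed

end
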